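(* The map $T$ (defined in the context) is self-equitable, i.e., $T(\mathbf{Y},\mathbf{h}(\mathbf{X}))=T(\mathbf{Y},\mathbf{X})$ for all $\mathbf{X}$, $\mathbf{Y}$ and all measurable functions $\mathbf{h}$ such that $\mathbf{Y}$ and $\mathbf{X}$ are conditionally independent given $\mathbf{h}(\mathbf{X})$.
   Context: All random vectors are defined on a common probability space $(\Omega,\mathcal{A},P)$: $\mathbf{X}=(X_1,\dots,X_p)$, $\mathbf{Y}=(Y_1,\dots,Y_q)$ with arbitrary $p,q\in\{1,2,\dots\}$. The components of $\mathbf{Y}$ are non-degenerate, i.e., no $Y_i$ is almost surely constant. For a non-degenerate real random variable $Y$ and a random vector $\mathbf{X}$ put $$\xi(Y,\mathbf{X}):=\frac{\int_{\mathbb{R}}\mathrm{Var}\big(P(Y\ge y\mid\mathbf{X})\big)\,\mathrm{d}P^{Y}(y)}{\int_{\mathbb{R}}\mathrm{Var}\big(\mathbf{1}_{\{Y\ge y\}}\big)\,\mathrm{d}P^{Y}(y)},$$ where $P^Y$ is the distribution of $Y$. Then $$T(\mathbf{Y},\mathbf{X}):=1-\frac{q-\sum_{i=1}^{q}\xi\big(Y_i,(\mathbf{X},Y_{i-1},\dots,Y_1)\big)}{q-\sum_{i=1}^{q}\xi\big(Y_i,(Y_{i-1},\dots,Y_1)\big)},\qquad \xi(Y_1,\emptyset):=0,$$ where for $i=1$ the vector $(\mathbf{X},Y_{i-1},\dots,Y_1)$ is $\mathbf{X}$ and $(Y_{i-1},\dots,Y_1)$ is empty. *)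

theory Defs
  imports "HOL-Probability.Probability"
begin

text \<open>Vectors in \<open>\<real>\<^sup>n\<close> are functions \<open>nat \<Rightarrow> real\<close> with components indexed by \<open>{1..n}\<close>, and
  \<open>undefined\<close> outside, as required by the product measurable space.\<close>

abbreviation borel_vec :: "nat \<Rightarrow> (nat \<Rightarrow> real) measure" where
  "borel_vec n \<equiv> PiM {1..n} (\<lambda>_. borel)"

definition vec_append :: "nat \<Rightarrow> (nat \<Rightarrow> real) \<Rightarrow> nat \<Rightarrow> (nat \<Rightarrow> real) \<Rightarrow> nat \<Rightarrow> real" where
  "vec_append n x m y = (\<lambda>k\<in>{1..n + m}. if k \<le> n then x k else y (k - n))"

text \<open>The vector \<open>(y\<^sub>i\<^sub>-\<^sub>1, \<dots>, y\<^sub>1)\<close> of length \<open>i - 1\<close>, in this order.\<close>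

definition preceding :: "nat \<Rightarrow> (nat \<Rightarrow> real) \<Rightarrow> nat \<Rightarrow> real" where
  "preceding i y = (\<lambda>k\<in>{1..i - 1}. y (i - k))"

text \<open>A version of \<open>P(A | Z)\<close>, where \<open>Z\<close> takes values in the measurable space \<open>N\<close>.\<close>

definition cond_probability ::
    "'a measure \<Rightarrow> 'b measure \<Rightarrow> ('a \<Rightarrow> 'b) \<Rightarrow> 'a set \<Rightarrow> 'a \<Rightarrow> real" where
  "cond_probability M N Z A = real_cond_exp M (vimage_algebra (space M) Z N) (indicator A)"

definition cond_indep_given ::
    "'a measure \<Rightarrow> 'b measure \<Rightarrow> ('a \<Rightarrow> 'b) \<Rightarrow> 'c measure \<Rightarrow> ('a \<Rightarrow> 'c) \<Rightarrow>
      'd measure \<Rightarrow> ('a \<Rightarrow> 'd) \<Rightarrow> bool" where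
  "cond_indep_given M N1 Y N2 X N3 Z \<longleftrightarrow>
    (\<forall>A\<in>sets N1. \<forall>B\<in>sets N2. AE \<omega> in M.
       cond_probability M N3 Z {\<omega>\<in>space M. Y \<omega> \<in> A \<and> X \<omega> \<in> B} \<omega> =
       cond_probability M N3 Z {\<omega>\<in>space M. Y \<omega> \<in> A} \<omega> *
       cond_probability M N3 Z {\<omega>\<in>space M. X \<omega> \<in> B} \<omega>)"

definition nondegenerate :: "'a measure \<Rightarrow> ('a \<Rightarrow> real) \<Rightarrow> bool" where
  "nondegenerate M Y \<longleftrightarrow> \<not> (\<exists>c. AE \<omega> in M. Y \<omega> = c)"

text \<open>The case \<open>n = 0\<close> is the convention \<open>\<xi>(Y, \<emptyset>) = 0\<close>.\<close>

definition xi :: "'a measure \<Rightarrow> ('a \<Rightarrow> real) \<Rightarrow> nat \<Rightarrow> ('a \<Rightarrow> nat \<Rightarrow> real) \<Rightarrow> real" where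
  "xi M Y n X = (if n = 0 then 0 else
    (\<integral>y. prob_space.variance M (cond_probability M (borel_vec n) X {\<omega>\<in>space M. Y \<omega> \<ge> y})
       \<partial>distr M borel Y) /
    (\<integral>y. prob_space.variance M (indicator {\<omega>\<in>space M. Y \<omega> \<ge> y}) \<partial>distr M borel Y))"

definition T ::
    "'a measure \<Rightarrow> nat \<Rightarrow> ('a \<Rightarrow> nat \<Rightarrow> real) \<Rightarrow> nat \<Rightarrow> ('a \<Rightarrow> nat \<Rightarrow> real) \<Rightarrow> real" where
  "T M q Y p X = 1 -
    (real q - (\<Sum>i=1..q. xi M (\<lambda>\<omega>. Y \<omega> i) (p + (i - 1))
                 (\<lambda>\<omega>. vec_append p (X \<omega>) (i - 1) (preceding i (Y \<omega>))))) /
    (real q - (\<Sum>i=1..q. xi M (\<lambda>\<omega>. Y \<omega> i) (i - 1) (\<lambda>\<omega>. preceding i (Y \<omega>))))"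

end

theory Submission
  imports Defs
begin

text \<open>Put \<open>Z = h(X)\<close>. Conditional independence of \<open>Y\<close> and \<open>X\<close> given \<open>Z\<close> means that
  \<open>P(X \<in> B | Z, Y) = P(X \<in> B | Z)\<close>. For every measurable \<open>u\<close> this passes to
  \<open>P(Y \<in> A | X, u(Y)) = P(Y \<in> A | Z, u(Y))\<close>, by testing both sides on rectangles
  \<open>{X \<in> B, u(Y) \<in> D}\<close>. With \<open>u(Y) = (Y\<^sub>i\<^sub>-\<^sub>1, \<dots>, Y\<^sub>1)\<close> and \<open>A = {Y\<^sub>i \<ge> y}\<close>, the conditional
  probabilities in each summand of \<open>T\<close> agree almost surely, so \<open>T\<close> does not change.\<close>

section \<open>Sigma-algebras generated by maps that factor through one another\<close>

lemma sets_vimage_algebra_subset_of_comp: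
  assumes X: "X \<in> \<Omega> \<rightarrow> space N" and f: "f \<in> measurable N L"
    and eq: "\<And>\<omega>. \<omega> \<in> \<Omega> \<Longrightarrow> Y \<omega> = f (X \<omega>)"
  shows "sets (vimage_algebra \<Omega> Y L) \<subseteq> sets (vimage_algebra \<Omega> X N)"
proof -
  have "Y \<in> measurable (vimage_algebra \<Omega> X N) L"
    using measurable_compose[OF measurable_vimage_algebra1[OF X] f]
    by (rule measurable_cong[THEN iffD1, rotated]) (simp add: eq)
  from sets_image_in_sets[OF _ this, of \<Omega>] show ?thesis by simp
qed

text \<open>Mutual measurable factorization gives both inclusions. The equality is one of measures,
  not merely of their families of sets, so that \<open>cond_probability\<close> can later be
  rewritten along it without an almost-sure argument.\<close>

lemma vimage_algebra_eq_of_comp: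
  assumes "X \<in> \<Omega> \<rightarrow> space N" "f \<in> measurable N L"
    and "Y \<in> \<Omega> \<rightarrow> space L" "g \<in> measurable L N"
    and "\<And>\<omega>. \<omega> \<in> \<Omega> \<Longrightarrow> Y \<omega> = f (X \<omega>)" "\<And>\<omega>. \<omega> \<in> \<Omega> \<Longrightarrow> X \<omega> = g (Y \<omega>)"
  shows "vimage_algebra \<Omega> Y L = vimage_algebra \<Omega> X N"
proof (rule measure_eqI)
  show "sets (vimage_algebra \<Omega> Y L) = sets (vimage_algebra \<Omega> X N)"
    using assms by (intro equalityI sets_vimage_algebra_subset_of_comp)
\<comment> \<open>Both sides are built by \<open>sigma\<close> and so carry the zero
  measure.\<close>
qed (simp add: vimage_algebra_def emeasure_sigma)

lemma measurable_imp_funcset: "X \<in> measurable M N \<Longrightarrow> X \<in> space M \<rightarrow> space N"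
  by (simp add: measurable_def)

lemma borel_measurable_mono_space:
  fixes f :: "'a \<Rightarrow> 'b::topological_space"
  assumes "f \<in> borel_measurable M" "sets M \<subseteq> sets N" "space M = space N"
  shows "f \<in> borel_measurable N"
  using measurable_mono[OF order_refl refl assms(2,3), of borel] assms(1) by blast

lemma subalgebra_vimage_algebra:
  assumes "X \<in> measurable M N"
  shows "subalgebra M (vimage_algebra (space M) X N)"
  unfolding subalgebra_def using sets_image_in_sets[OF refl assms] by simp

section \<open>Conditional probabilities given a pair\<close>

context prob_space
begin

lemma integrable_event_indicator:
  "A \<in> sets M \<Longrightarrow> integrable M (indicator A :: 'a \<Rightarrow> real)"
  by (rule integrable_const_bound[of _ 1]) auto

lemma sigma_finite_subalgebra_vimage:
  assumes "X \<in> measurable M N"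
  shows "sigma_finite_subalgebra M (vimage_algebra (space M) X N)"
proof -
  interpret finite_measure_subalgebra M "vimage_algebra (space M) X N"
    by unfold_locales (rule subalgebra_vimage_algebra[OF assms])
  show ?thesis by unfold_locales
qed

text \<open>Rectangles form an intersection-stable generator of the product sigma-algebra, and the
  sets \<open>C\<close> satisfying the equation form a Dynkin system. The induction works with
  integrals directly because \<open>f\<close> and \<open>g\<close> may take both signs, so they need
  not be densities of measures.\<close>

lemma integral_eq_on_vimage_pair:
  fixes f g :: "'a \<Rightarrow> real"
  assumes X[measurable]: "X \<in> measurable M N" and U[measurable]: "U \<in> measurable M L"
    and f: "integrable M f" and g: "integrable M g"
    and rect: "\<And>B D. B \<in> sets N \<Longrightarrow> D \<in> sets L \<Longrightarrow>
      (\<integral>\<omega>. indicator B (X \<omega>) * indicator D (U \<omega>) * f \<omega> \<partial>M) =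
      (\<integral>\<omega>. indicator B (X \<omega>) * indicator D (U \<omega>) * g \<omega> \<partial>M)"
    and C: "C \<in> sets (N \<Otimes>\<^sub>M L)"
  shows "(\<integral>\<omega>. indicator C (X \<omega>, U \<omega>) * f \<omega> \<partial>M) = (\<integral>\<omega>. indicator C (X \<omega>, U \<omega>) * g \<omega> \<partial>M)"
proof -
  let ?G = "{a \<times> b |a b. a \<in> sets N \<and> b \<in> sets L}" and ?S = "space N \<times> space L"
  have V[measurable]: "(\<lambda>\<omega>. (X \<omega>, U \<omega>)) \<in> measurable M (N \<Otimes>\<^sub>M L)" by measurable
  have sp: "X \<omega> \<in> space N" "U \<omega> \<in> space L" if "\<omega> \<in> space M" for \<omega>
    using that measurable_space[OF X] measurable_space[OF U] by simp_all
  have int: "integrable M (\<lambda>\<omega>. indicator A (X \<omega>, U \<omega>) * k \<omega>)"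
    if "A \<in> sets (N \<Otimes>\<^sub>M L)" "integrable M k" for A and k :: "'a \<Rightarrow> real"
  proof -
    have [measurable]: "k \<in> borel_measurable M" "A \<in> sets (N \<Otimes>\<^sub>M L)" using that by auto
    show ?thesis
      by (rule Bochner_Integration.integrable_bound[OF that(2)])
        (auto intro!: AE_I2 simp: indicator_def)
  qed
  have "C \<in> sigma_sets ?S ?G" using C by (simp add: sets_pair_measure)
  with Int_stable_pair_measure_generator pair_measure_closed show ?thesis
  proof (induction rule: sigma_sets_induct_disjoint)
    case (basic A)
    then obtain a b where "A = a \<times> b" "a \<in> sets N" "b \<in> sets L" by blast
    then show ?case using rect[of a b] by (simp add: indicator_times)
  next
    case empty
    then show ?case by simp
  next
    case (compl A)
    then have A: "A \<in> sets (N \<Otimes>\<^sub>M L)" by (simp add: sets_pair_measure)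
    have *: "(\<integral>\<omega>. indicator (?S - A) (X \<omega>, U \<omega>) * k \<omega> \<partial>M) =
      (\<integral>\<omega>. k \<omega> \<partial>M) - (\<integral>\<omega>. indicator A (X \<omega>, U \<omega>) * k \<omega> \<partial>M)"
      if "integrable M k" for k :: "'a \<Rightarrow> real"
      unfolding Bochner_Integration.integral_diff[OF that int[OF A that], symmetric]
      by (rule Bochner_Integration.integral_cong) (auto simp: indicator_def sp)
    \<comment> \<open>The whole space is itself a rectangle, so \<open>rect\<close> also equates the
      total integrals from which the integral over \<open>A\<close> is subtracted.\<close>
    have "(\<integral>\<omega>. k \<omega> \<partial>M) = (\<integral>\<omega>. indicator (space N) (X \<omega>) * indicator (space L) (U \<omega>) * k \<omega> \<partial>M)"
      for k :: "'a \<Rightarrow> real"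
      by (rule Bochner_Integration.integral_cong) (auto simp: sp)
    then show ?case using compl(2) rect[of "space N" "space L"] by (simp add: *[OF f] *[OF g])
  next
    case (union A)
    then have A: "range A \<subseteq> sets (N \<Otimes>\<^sub>M L)" by (simp add: sets_pair_measure)
    let ?V = "\<lambda>n. (\<lambda>\<omega>. (X \<omega>, U \<omega>)) -` A n \<inter> space M"
    have mV: "?V n \<in> sets M" for n using A measurable_sets[OF V] by blast
    have dV: "disjoint_family ?V" using union(1) by (fastforce simp: disjoint_family_on_def)
    have eq: "(\<integral>\<omega>. indicator E (X \<omega>, U \<omega>) * k \<omega> \<partial>M) =
      (LINT \<omega>:((\<lambda>\<omega>. (X \<omega>, U \<omega>)) -` E \<inter> space M)|M. k \<omega>)" for E and k :: "'a \<Rightarrow> real"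
      unfolding set_lebesgue_integral_def
      by (rule Bochner_Integration.integral_cong) (auto simp: indicator_def)
    have *: "(\<integral>\<omega>. indicator (\<Union>n. A n) (X \<omega>, U \<omega>) * k \<omega> \<partial>M) =
      (\<Sum>n. \<integral>\<omega>. indicator (A n) (X \<omega>, U \<omega>) * k \<omega> \<partial>M)" if k: "integrable M k" for k :: "'a \<Rightarrow> real"
    proof -
      \<comment> \<open>Integrability over the union is what makes the integral of the signed
        function \<open>k\<close> countably additive over the disjoint preimages.\<close>
      have "set_integrable M (\<Union>n. ?V n) k"
        unfolding set_integrable_def using mV k
        by (intro integrable_mult_indicator sets.countable_UN) auto
      then have "(LINT \<omega>:(\<Union>n. ?V n)|M. k \<omega>) = (\<Sum>n. LINT \<omega>:?V n|M. k \<omega>)"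
        using dV mV by (intro lebesgue_integral_countable_add) (auto simp: disjoint_family_on_def)
      then show ?thesis unfolding eq by (simp add: vimage_UN)
    qed
    show ?case using union(3) by (simp add: *[OF f] *[OF g])
  qed
qed

text \<open>Every set of \<open>F\<close> is a preimage of some \<open>C\<close> in the product
  sigma-algebra, so the defining property of conditional expectation needs to be tested on
  rectangles only.\<close>

lemma real_cond_exp_vimage_pair_charact:
  fixes f g :: "'a \<Rightarrow> real" and X :: "'a \<Rightarrow> 'b" and U :: "'a \<Rightarrow> 'c" and N L
  defines "F \<equiv> vimage_algebra (space M) (\<lambda>\<omega>. (X \<omega>, U \<omega>)) (N \<Otimes>\<^sub>M L)"
  assumes X[measurable]: "X \<in> measurable M N" and U[measurable]: "U \<in> measurable M L"
    and f: "integrable M f" and g: "integrable M g" and gm: "g \<in> borel_measurable F"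
    and rect: "\<And>B D. B \<in> sets N \<Longrightarrow> D \<in> sets L \<Longrightarrow>
      (\<integral>\<omega>. indicator B (X \<omega>) * indicator D (U \<omega>) * f \<omega> \<partial>M) =
      (\<integral>\<omega>. indicator B (X \<omega>) * indicator D (U \<omega>) * g \<omega> \<partial>M)"
  shows "AE \<omega> in M. real_cond_exp M F f \<omega> = g \<omega>"
proof -
  have V: "(\<lambda>\<omega>. (X \<omega>, U \<omega>)) \<in> measurable M (N \<Otimes>\<^sub>M L)" by measurable
  interpret sigma_finite_subalgebra M F
    unfolding F_def by (rule sigma_finite_subalgebra_vimage[OF V])
  show ?thesis
  proof (rule real_cond_exp_charact[OF _ f g gm])
    fix A assume "A \<in> sets F"
    then obtain C where C: "C \<in> sets (N \<Otimes>\<^sub>M L)" "A = (\<lambda>\<omega>. (X \<omega>, U \<omega>)) -` C \<inter> space M"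
      unfolding F_def sets_vimage_algebra2[OF measurable_imp_funcset[OF V]] by blast
    have eq: "(LINT \<omega>:A|M. k \<omega>) = (\<integral>\<omega>. indicator C (X \<omega>, U \<omega>) * k \<omega> \<partial>M)" for k :: "'a \<Rightarrow> real"
      unfolding set_lebesgue_integral_def C(2)
      by (rule Bochner_Integration.integral_cong) (auto simp: indicator_def)
    show "(LINT \<omega>:A|M. f \<omega>) = (LINT \<omega>:A|M. g \<omega>)"
      unfolding eq by (rule integral_eq_on_vimage_pair[OF X U f g rect C(1)])
  qed
qed

text \<open>The exchange rule behind all later computations. Integrability of \<open>f\<close>
  suffices in place of boundedness, as the indicator is bounded; this admits test functions that
  contain other conditional probabilities.\<close>

lemma integral_mult_cond_probability:
  fixes f :: "'a \<Rightarrow> real"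
  assumes Z: "Z \<in> measurable M N" and A: "A \<in> sets M"
    and f: "f \<in> borel_measurable (vimage_algebra (space M) Z N)" "integrable M f"
  shows "(\<integral>\<omega>. f \<omega> * cond_probability M N Z A \<omega> \<partial>M) = (\<integral>\<omega>. f \<omega> * indicator A \<omega> \<partial>M)"
proof -
  interpret sigma_finite_subalgebra M "vimage_algebra (space M) Z N"
    by (rule sigma_finite_subalgebra_vimage[OF Z])
  show ?thesis
    unfolding cond_probability_def using A f
    by (intro real_cond_exp_intg(2)) (auto intro: integrable_real_mult_indicator)
qed

lemma
  assumes Z: "Z \<in> measurable M N" and A: "A \<in> sets M"
  shows cond_probability_measurable:
      "cond_probability M N Z A \<in> borel_measurable (vimage_algebra (space M) Z N)"
    and integrable_cond_probability: "integrable M (cond_probability M N Z A)"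
proof -
  interpret sigma_finite_subalgebra M "vimage_algebra (space M) Z N"
    by (rule sigma_finite_subalgebra_vimage[OF Z])
  show "cond_probability M N Z A \<in> borel_measurable (vimage_algebra (space M) Z N)"
    unfolding cond_probability_def by simp
  show "integrable M (cond_probability M N Z A)"
    unfolding cond_probability_def using A by (intro real_cond_exp_int(1) integrable_event_indicator)
qed

section \<open>Consequences of conditional independence\<close>

text \<open>Turns the product formula into its asymmetric form. On a rectangle \<open>H\<close>,
  \<open>D\<close>, the joint conditional probability splits into \<open>?\<beta>\<close> times
  \<open>?\<delta>\<close>, and \<open>?\<delta>\<close> is then exchanged for the indicator of
  \<open>Y \<omega> \<in> D\<close>.\<close>

lemma cond_indep_given_cond_probability_pair:
  assumes Y[measurable]: "Y \<in> measurable M N" and X[measurable]: "X \<in> measurable M L"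
    and Z[measurable]: "Z \<in> measurable M K"
    and indep: "cond_indep_given M N Y L X K Z" and B[measurable]: "B \<in> sets L"
  shows "AE \<omega> in M. cond_probability M (K \<Otimes>\<^sub>M N) (\<lambda>\<omega>. (Z \<omega>, Y \<omega>)) {\<omega>\<in>space M. X \<omega> \<in> B} \<omega> =
    cond_probability M K Z {\<omega>\<in>space M. X \<omega> \<in> B} \<omega>"
    (is "AE \<omega> in M. _ = ?\<beta> \<omega>")
  unfolding cond_probability_def[of M "K \<Otimes>\<^sub>M N"]
proof (rule real_cond_exp_vimage_pair_charact[OF Z Y])
  let ?b = "indicator {\<omega>\<in>space M. X \<omega> \<in> B} :: 'a \<Rightarrow> real" and ?F = "vimage_algebra (space M) Z K"
  have \<beta>F[measurable]: "?\<beta> \<in> borel_measurable ?F" and \<beta>: "integrable M ?\<beta>"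
    by (auto intro!: cond_probability_measurable integrable_cond_probability)
  have ZF[measurable]: "Z \<in> measurable ?F K"
    by (intro measurable_vimage_algebra1 measurable_imp_funcset[OF Z])
  show "integrable M ?b" by (rule integrable_event_indicator) measurable
  show "integrable M ?\<beta>" by (rule \<beta>)
  have "sets ?F \<subseteq> sets (vimage_algebra (space M) (\<lambda>\<omega>. (Z \<omega>, Y \<omega>)) (K \<Otimes>\<^sub>M N))"
    using measurable_space[OF Z] measurable_space[OF Y]
    by (intro sets_vimage_algebra_subset_of_comp[OF _ measurable_fst])
      (auto simp: space_pair_measure)
  from borel_measurable_mono_space[OF \<beta>F this]
  show "?\<beta> \<in> borel_measurable (vimage_algebra (space M) (\<lambda>\<omega>. (Z \<omega>, Y \<omega>)) (K \<Otimes>\<^sub>M N))"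
    by simp
  fix H D assume [measurable]: "H \<in> sets K" "D \<in> sets N"
  let ?\<delta> = "cond_probability M K Z {\<omega>\<in>space M. Y \<omega> \<in> D}"
  let ?\<eta> = "cond_probability M K Z {\<omega>\<in>space M. Y \<omega> \<in> D \<and> X \<omega> \<in> B}"
  have mM: "?\<beta> \<in> borel_measurable M" "?\<delta> \<in> borel_measurable M" "?\<eta> \<in> borel_measurable M"
    by (auto intro!: borel_measurable_integrable integrable_cond_probability)
  have i1: "integrable M (\<lambda>\<omega>. indicator H (Z \<omega>) :: real)"
    by (rule integrable_const_bound[of _ 1]) auto
  have i2: "integrable M (\<lambda>\<omega>. indicator H (Z \<omega>) * ?\<beta> \<omega>)"
    by (rule Bochner_Integration.integrable_bound[OF \<beta>])
      (use mM in \<open>auto intro!: AE_I2 simp: indicator_def\<close>)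
  have "(\<integral>\<omega>. indicator H (Z \<omega>) * indicator D (Y \<omega>) * ?b \<omega> \<partial>M) =
      (\<integral>\<omega>. indicator H (Z \<omega>) * indicator {\<omega>\<in>space M. Y \<omega> \<in> D \<and> X \<omega> \<in> B} \<omega> \<partial>M)"
    by (rule Bochner_Integration.integral_cong) (auto simp: indicator_def)
  also have "\<dots> = (\<integral>\<omega>. indicator H (Z \<omega>) * ?\<eta> \<omega> \<partial>M)"
    by (rule integral_mult_cond_probability[symmetric]) (use i1 in auto)
  also have "\<dots> = (\<integral>\<omega>. indicator H (Z \<omega>) * ?\<beta> \<omega> * ?\<delta> \<omega> \<partial>M)"
  proof (rule integral_cong_AE)
    have "AE \<omega> in M. ?\<eta> \<omega> = ?\<delta> \<omega> * ?\<beta> \<omega>"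
      using indep unfolding cond_indep_given_def by simp
    then show "AE \<omega> in M. indicator H (Z \<omega>) * ?\<eta> \<omega> = indicator H (Z \<omega>) * ?\<beta> \<omega> * ?\<delta> \<omega>" by auto
  qed (use mM in auto)
  \<comment> \<open>The remaining factor \<open>indicator H (Z \<omega>) * ?\<beta> \<omega>\<close>
    is measurable with respect to \<open>Z\<close>, hence an admissible test function.\<close>
  also have "\<dots> = (\<integral>\<omega>. indicator H (Z \<omega>) * ?\<beta> \<omega> * indicator {\<omega>\<in>space M. Y \<omega> \<in> D} \<omega> \<partial>M)"
    by (rule integral_mult_cond_probability) (use i2 in auto)
  also have "\<dots> = (\<integral>\<omega>. indicator H (Z \<omega>) * indicator D (Y \<omega>) * ?\<beta> \<omega> \<partial>M)"
    by (rule Bochner_Integration.integral_cong) (auto simp: indicator_def)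
  finally show "(\<integral>\<omega>. indicator H (Z \<omega>) * indicator D (Y \<omega>) * ?b \<omega> \<partial>M) =
      (\<integral>\<omega>. indicator H (Z \<omega>) * indicator D (Y \<omega>) * ?\<beta> \<omega> \<partial>M)" .
qed

text \<open>Beyond \<open>h (X \<omega>)\<close> and \<open>u (Y \<omega>)\<close>, the value of
  \<open>X\<close> carries no information on \<open>Y\<close>. On a rectangle, the event
  \<open>X \<omega> \<in> B\<close> is averaged to \<open>?\<beta>\<close>, then the event
  \<open>Y \<omega> \<in> A\<close> to \<open>?\<phi>\<close>, and finally \<open>?\<beta>\<close>
  is turned back into the event.\<close>

lemma cond_indep_given_comp_cond_probability_eq:
  assumes Y[measurable]: "Y \<in> measurable M N" and X[measurable]: "X \<in> measurable M L"
    and h[measurable]: "h \<in> measurable L K" and u[measurable]: "u \<in> measurable N J"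
    and indep: "cond_indep_given M N Y L X K (\<lambda>\<omega>. h (X \<omega>))" and A[measurable]: "A \<in> sets N"
  shows "AE \<omega> in M.
    cond_probability M (L \<Otimes>\<^sub>M J) (\<lambda>\<omega>. (X \<omega>, u (Y \<omega>))) {\<omega>\<in>space M. Y \<omega> \<in> A} \<omega> =
    cond_probability M (K \<Otimes>\<^sub>M J) (\<lambda>\<omega>. (h (X \<omega>), u (Y \<omega>))) {\<omega>\<in>space M. Y \<omega> \<in> A} \<omega>"
    (is "AE \<omega> in M. _ = ?\<phi> \<omega>")
  unfolding cond_probability_def[of M "L \<Otimes>\<^sub>M J"]
proof (rule real_cond_exp_vimage_pair_charact[OF X])
  let ?a = "indicator {\<omega>\<in>space M. Y \<omega> \<in> A} :: 'a \<Rightarrow> real"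
  let ?F = "vimage_algebra (space M) (\<lambda>\<omega>. h (X \<omega>)) K"
  let ?W = "vimage_algebra (space M) (\<lambda>\<omega>. (h (X \<omega>), u (Y \<omega>))) (K \<Otimes>\<^sub>M J)"
  let ?G = "vimage_algebra (space M) (\<lambda>\<omega>. (h (X \<omega>), Y \<omega>)) (K \<Otimes>\<^sub>M N)"
  let ?V = "vimage_algebra (space M) (\<lambda>\<omega>. (X \<omega>, u (Y \<omega>))) (L \<Otimes>\<^sub>M J)"
  have sp: "X \<omega> \<in> space L" "Y \<omega> \<in> space N" "h (X \<omega>) \<in> space K" "u (Y \<omega>) \<in> space J"
    if "\<omega> \<in> space M" for \<omega>
    using that measurable_space[OF X] measurable_space[OF Y] measurable_space[OF h]
      measurable_space[OF u] by simp_all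
  \<comment> \<open>\<open>?F\<close> lies in \<open>?W\<close>, and \<open>?W\<close> lies in both
    \<open>?G\<close> and \<open>?V\<close>. Thus \<open>?\<beta>\<close> and \<open>?\<phi>\<close>
    are \<open>?W\<close>-measurable, and \<open>?\<phi>\<close> may also serve as a test function
    over \<open>?G\<close> and as a candidate over \<open>?V\<close>.\<close>
  have FW: "sets ?F \<subseteq> sets ?W"
    by (intro sets_vimage_algebra_subset_of_comp[OF _ measurable_fst])
      (auto simp: space_pair_measure sp)
  have WG: "sets ?W \<subseteq> sets ?G"
    by (rule sets_vimage_algebra_subset_of_comp[where f = "\<lambda>(z, y). (z, u y)"])
      (auto simp: space_pair_measure sp)
  have WV: "sets ?W \<subseteq> sets ?V"
    by (rule sets_vimage_algebra_subset_of_comp[where f = "\<lambda>(x, y). (h x, y)"])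
      (auto simp: space_pair_measure sp)
  have uG: "(\<lambda>\<omega>. u (Y \<omega>)) \<in> measurable ?G J" and AG: "{\<omega>\<in>space M. Y \<omega> \<in> A} \<in> sets ?G"
  proof -
    have "(\<lambda>\<omega>. (h (X \<omega>), Y \<omega>)) \<in> measurable ?G (K \<Otimes>\<^sub>M N)"
      by (intro measurable_vimage_algebra1) (auto simp: space_pair_measure sp)
    from measurable_compose[OF this measurable_snd] have [measurable]: "Y \<in> measurable ?G N" by simp
    show "(\<lambda>\<omega>. u (Y \<omega>)) \<in> measurable ?G J" by measurable
    have "{\<omega>\<in>space ?G. Y \<omega> \<in> A} \<in> sets ?G" by measurable
    then show "{\<omega>\<in>space M. Y \<omega> \<in> A} \<in> sets ?G" by simp
  qed
  have uW: "(\<lambda>\<omega>. u (Y \<omega>)) \<in> measurable ?W J"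
  proof -
    have "(\<lambda>\<omega>. (h (X \<omega>), u (Y \<omega>))) \<in> measurable ?W (K \<Otimes>\<^sub>M J)"
      by (intro measurable_vimage_algebra1) (auto simp: space_pair_measure sp)
    from measurable_compose[OF this measurable_snd] show ?thesis by simp
  qed
  have \<phi>W: "?\<phi> \<in> borel_measurable ?W" and \<phi>: "integrable M ?\<phi>"
    by (auto intro!: cond_probability_measurable integrable_cond_probability)
  show "(\<lambda>\<omega>. u (Y \<omega>)) \<in> measurable M J" by measurable
  show "integrable M ?a" by (rule integrable_event_indicator) measurable
  show "integrable M ?\<phi>" by (rule \<phi>)
  show "?\<phi> \<in> borel_measurable ?V" using borel_measurable_mono_space[OF \<phi>W WV] by simp
  fix B D assume [measurable]: "B \<in> sets L" "D \<in> sets J"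
  let ?B = "{\<omega>\<in>space M. X \<omega> \<in> B}"
  let ?\<beta> = "cond_probability M K (\<lambda>\<omega>. h (X \<omega>)) ?B"
  let ?\<gamma> = "cond_probability M (K \<Otimes>\<^sub>M N) (\<lambda>\<omega>. (h (X \<omega>), Y \<omega>)) ?B"
  have \<beta>F: "?\<beta> \<in> borel_measurable ?F" and \<beta>: "integrable M ?\<beta>" and \<gamma>: "integrable M ?\<gamma>"
    by (auto intro!: cond_probability_measurable integrable_cond_probability)
  have \<beta>W: "?\<beta> \<in> borel_measurable ?W"
    using borel_measurable_mono_space[OF \<beta>F FW] by simp
  note [measurable] = borel_measurable_integrable[OF \<beta>] borel_measurable_integrable[OF \<gamma>]
    borel_measurable_integrable[OF \<phi>]
  have \<gamma>\<beta>: "AE \<omega> in M. ?\<gamma> \<omega> = ?\<beta> \<omega>"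
    by (rule cond_indep_given_cond_probability_pair[OF Y X _ indep]) auto
  \<comment> \<open>The only use of conditional independence: given all of \<open>?G\<close>, the
    conditional probability of \<open>?B\<close> is already \<open>?\<beta>\<close>.\<close>
  have test: "(\<integral>\<omega>. k \<omega> * indicator ?B \<omega> \<partial>M) = (\<integral>\<omega>. k \<omega> * ?\<beta> \<omega> \<partial>M)"
    if "k \<in> borel_measurable ?G" and k: "integrable M k" for k :: "'a \<Rightarrow> real"
  proof -
    have "(\<integral>\<omega>. k \<omega> * indicator ?B \<omega> \<partial>M) = (\<integral>\<omega>. k \<omega> * ?\<gamma> \<omega> \<partial>M)"
      by (rule integral_mult_cond_probability[symmetric]) (use that in auto)
    also have "\<dots> = (\<integral>\<omega>. k \<omega> * ?\<beta> \<omega> \<partial>M)"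
      by (rule integral_cong_AE) (use \<gamma>\<beta> borel_measurable_integrable[OF k] in auto)
    finally show ?thesis .
  qed
  have i1: "integrable M (\<lambda>\<omega>. indicator D (u (Y \<omega>)) * ?a \<omega>)"
    by (rule integrable_const_bound[of _ 1]) (auto simp: indicator_def)
  have i2: "integrable M (\<lambda>\<omega>. indicator D (u (Y \<omega>)) * ?\<beta> \<omega>)"
    by (rule Bochner_Integration.integrable_bound[OF \<beta>]) (auto intro!: AE_I2 simp: indicator_def)
  have i3: "integrable M (\<lambda>\<omega>. indicator D (u (Y \<omega>)) * ?\<phi> \<omega>)"
    by (rule Bochner_Integration.integrable_bound[OF \<phi>]) (auto intro!: AE_I2 simp: indicator_def)
  have DG: "(\<lambda>\<omega>. indicator D (u (Y \<omega>)) :: real) \<in> borel_measurable ?G"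
    and DW: "(\<lambda>\<omega>. indicator D (u (Y \<omega>)) :: real) \<in> borel_measurable ?W"
    by (auto intro: measurable_compose[OF uG borel_measurable_indicator]
        measurable_compose[OF uW borel_measurable_indicator])
  have "(\<integral>\<omega>. indicator B (X \<omega>) * indicator D (u (Y \<omega>)) * ?a \<omega> \<partial>M) =
      (\<integral>\<omega>. indicator D (u (Y \<omega>)) * ?a \<omega> * indicator ?B \<omega> \<partial>M)"
    by (rule Bochner_Integration.integral_cong) (auto simp: indicator_def)
  also have "\<dots> = (\<integral>\<omega>. indicator D (u (Y \<omega>)) * ?a \<omega> * ?\<beta> \<omega> \<partial>M)"
    by (rule test) (use i1 DG AG in auto)
  also have "\<dots> = (\<integral>\<omega>. indicator D (u (Y \<omega>)) * ?\<beta> \<omega> * ?a \<omega> \<partial>M)"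
    by (simp add: mult_ac)
  \<comment> \<open>With \<open>?B\<close> replaced by \<open>?\<beta>\<close>, the cofactor of
    \<open>?a\<close> is \<open>?W\<close>-measurable, which permits the exchange with
    \<open>?\<phi>\<close>.\<close>
  also have "\<dots> = (\<integral>\<omega>. indicator D (u (Y \<omega>)) * ?\<beta> \<omega> * ?\<phi> \<omega> \<partial>M)"
    by (rule integral_mult_cond_probability[symmetric]) (use i2 DW \<beta>W in auto)
  also have "\<dots> = (\<integral>\<omega>. indicator D (u (Y \<omega>)) * ?\<phi> \<omega> * ?\<beta> \<omega> \<partial>M)"
    by (simp add: mult_ac)
  \<comment> \<open>\<open>test\<close> read backwards, now with a cofactor containing
    \<open>?\<phi>\<close>.\<close>
  also have "\<dots> = (\<integral>\<omega>. indicator D (u (Y \<omega>)) * ?\<phi> \<omega> * indicator ?B \<omega> \<partial>M)"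
    by (rule test[symmetric]) (use i3 DG borel_measurable_mono_space[OF \<phi>W WG] in auto)
  also have "\<dots> = (\<integral>\<omega>. indicator B (X \<omega>) * indicator D (u (Y \<omega>)) * ?\<phi> \<omega> \<partial>M)"
    by (rule Bochner_Integration.integral_cong) (auto simp: indicator_def)
  finally show "(\<integral>\<omega>. indicator B (X \<omega>) * indicator D (u (Y \<omega>)) * ?a \<omega> \<partial>M) =
      (\<integral>\<omega>. indicator B (X \<omega>) * indicator D (u (Y \<omega>)) * ?\<phi> \<omega> \<partial>M)" .
qed

section \<open>Variances and concatenated vectors\<close>

lemma variance_cong_AE:
  fixes f g :: "'a \<Rightarrow> real"
  assumes "f \<in> borel_measurable M" "g \<in> borel_measurable M" "AE \<omega> in M. f \<omega> = g \<omega>"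
  shows "variance f = variance g"
proof -
  have "expectation f = expectation g" using assms by (rule integral_cong_AE)
  then show ?thesis using assms by (intro integral_cong_AE) auto
qed

end

lemma measurable_vec_append:
  "(\<lambda>(x, y). vec_append n x m y) \<in> measurable (borel_vec n \<Otimes>\<^sub>M borel_vec m) (borel_vec (n + m))"
  unfolding vec_append_def case_prod_beta
proof (rule measurable_restrict)
  fix k assume "k \<in> {1..n + m}"
  then show "(\<lambda>p. if k \<le> n then fst p k else snd p (k - n))
      \<in> borel_measurable (borel_vec n \<Otimes>\<^sub>M borel_vec m)"
    by (cases "k \<le> n")
      (auto intro!: measurable_compose[OF measurable_fst] measurable_compose[OF measurable_snd]
        measurable_component_singleton)
qed

lemma measurable_preceding:
  assumes "i \<in> {1..q}"
  shows "preceding i \<in> measurable (borel_vec q) (borel_vec (i - 1))"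
  unfolding preceding_def
  by (intro measurable_restrict measurable_component_singleton) (use assms in auto)

text \<open>Concatenation has a measurable inverse that cuts the vector after position
  \<open>n\<close>. Conditioning on the vector in \<open>T\<close> is therefore conditioning on a
  pair.\<close>

lemma vimage_algebra_vec_append:
  assumes X: "X \<in> \<Omega> \<rightarrow> space (borel_vec n)" and U: "U \<in> \<Omega> \<rightarrow> space (borel_vec m)"
  shows "vimage_algebra \<Omega> (\<lambda>\<omega>. vec_append n (X \<omega>) m (U \<omega>)) (borel_vec (n + m)) =
    vimage_algebra \<Omega> (\<lambda>\<omega>. (X \<omega>, U \<omega>)) (borel_vec n \<Otimes>\<^sub>M borel_vec m)"
proof (rule vimage_algebra_eq_of_comp[OF _ measurable_vec_append,
      where g = "\<lambda>v. (\<lambda>k\<in>{1..n}. v k, \<lambda>k\<in>{1..m}. v (k + n))"])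
  show "(\<lambda>v. (\<lambda>k\<in>{1..n}. v k, \<lambda>k\<in>{1..m}. v (k + n)))
      \<in> measurable (borel_vec (n + m)) (borel_vec n \<Otimes>\<^sub>M borel_vec m)"
    by (intro measurable_Pair measurable_restrict measurable_component_singleton) auto
  show "(\<lambda>\<omega>. vec_append n (X \<omega>) m (U \<omega>)) \<in> \<Omega> \<rightarrow> space (borel_vec (n + m))"
    by (auto simp: vec_append_def space_PiM)
next
  \<comment> \<open>Cutting recovers the two vectors exactly only because both are
    \<open>undefined\<close> outside their index ranges.\<close>
  fix \<omega> assume "\<omega> \<in> \<Omega>"
  then have "X \<omega> \<in> extensional {1..n}" "U \<omega> \<in> extensional {1..m}"
    using X U by (auto simp: space_PiM PiE_def)
  then show "(X \<omega>, U \<omega>) = (\<lambda>k\<in>{1..n}. vec_append n (X \<omega>) m (U \<omega>) k,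
      \<lambda>k\<in>{1..m}. vec_append n (X \<omega>) m (U \<omega>) (k + n))"
    by (auto simp: vec_append_def restrict_def extensional_def fun_eq_iff)
qed (use X U in \<open>auto simp: space_pair_measure\<close>)

theorem corollary2p3:
  fixes M :: "'a measure"
    and p q r :: nat
    and X Y :: "'a \<Rightarrow> nat \<Rightarrow> real"
    and h :: "(nat \<Rightarrow> real) \<Rightarrow> nat \<Rightarrow> real"
  assumes "prob_space M"
    and "p \<ge> 1" and "q \<ge> 1" and "r \<ge> 1"
    and "X \<in> measurable M (borel_vec p)"
    and "Y \<in> measurable M (borel_vec q)"
    and "\<And>i. i \<in> {1..q} \<Longrightarrow> nondegenerate M (\<lambda>\<omega>. Y \<omega> i)"
    and "h \<in> measurable (borel_vec p) (borel_vec r)"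
    and "cond_indep_given M (borel_vec q) Y (borel_vec p) X (borel_vec r) (\<lambda>\<omega>. h (X \<omega>))"
  shows "T M q Y r (\<lambda>\<omega>. h (X \<omega>)) = T M q Y p X"
proof -
  interpret prob_space M by fact
  note X[measurable] = \<open>X \<in> measurable M (borel_vec p)\<close>
    and Y[measurable] = \<open>Y \<in> measurable M (borel_vec q)\<close>
    and h[measurable] = \<open>h \<in> measurable (borel_vec p) (borel_vec r)\<close>
  \<comment> \<open>\<open>X\<close> enters \<open>T\<close> only through the sum in the numerator,
    so termwise equality suffices.\<close>
  have "xi M (\<lambda>\<omega>. Y \<omega> i) (r + (i - 1))
      (\<lambda>\<omega>. vec_append r (h (X \<omega>)) (i - 1) (preceding i (Y \<omega>))) =
    xi M (\<lambda>\<omega>. Y \<omega> i) (p + (i - 1)) (\<lambda>\<omega>. vec_append p (X \<omega>) (i - 1) (preceding i (Y \<omega>)))"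
    if i: "i \<in> {1..q}" for i
  proof -
    note pre[measurable] = measurable_preceding[OF i]
    have sp: "X \<in> space M \<rightarrow> space (borel_vec p)"
      "(\<lambda>\<omega>. h (X \<omega>)) \<in> space M \<rightarrow> space (borel_vec r)"
      "(\<lambda>\<omega>. preceding i (Y \<omega>)) \<in> space M \<rightarrow> space (borel_vec (i - 1))"
      by (rule measurable_imp_funcset, measurable)+
    \<comment> \<open>Equality at every threshold \<open>y\<close> makes the integrands in the
      numerators of \<open>xi\<close> identical; the denominators do not involve
      \<open>X\<close>.\<close>
    have "variance (cond_probability M (borel_vec (r + (i - 1)))
          (\<lambda>\<omega>. vec_append r (h (X \<omega>)) (i - 1) (preceding i (Y \<omega>))) {\<omega>\<in>space M. Y \<omega> i \<ge> y}) =
        variance (cond_probability M (borel_vec (p + (i - 1)))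
          (\<lambda>\<omega>. vec_append p (X \<omega>) (i - 1) (preceding i (Y \<omega>))) {\<omega>\<in>space M. Y \<omega> i \<ge> y})" for y
    proof -
      let ?A = "{v \<in> space (borel_vec q). v i \<ge> y}"
      have [measurable]: "(\<lambda>v. v i) \<in> borel_measurable (borel_vec q)"
        using i by (rule measurable_component_singleton)
      have A: "?A \<in> sets (borel_vec q)" by measurable
      have ev: "{\<omega>\<in>space M. Y \<omega> i \<ge> y} = {\<omega>\<in>space M. Y \<omega> \<in> ?A}"
        using measurable_space[OF Y] by auto
      have AM: "{\<omega>\<in>space M. Y \<omega> \<in> ?A} \<in> sets M" using A by measurable
      have pair: "cond_probability M (borel_vec (n + (i - 1)))
          (\<lambda>\<omega>. vec_append n (Z \<omega>) (i - 1) (preceding i (Y \<omega>))) =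
        cond_probability M (borel_vec n \<Otimes>\<^sub>M borel_vec (i - 1)) (\<lambda>\<omega>. (Z \<omega>, preceding i (Y \<omega>)))"
        if "Z \<in> space M \<rightarrow> space (borel_vec n)" for n Z
        unfolding cond_probability_def vimage_algebra_vec_append[OF that sp(3)] ..
      have "AE \<omega> in M.
          cond_probability M (borel_vec p \<Otimes>\<^sub>M borel_vec (i - 1))
            (\<lambda>\<omega>. (X \<omega>, preceding i (Y \<omega>))) {\<omega>\<in>space M. Y \<omega> \<in> ?A} \<omega> =
          cond_probability M (borel_vec r \<Otimes>\<^sub>M borel_vec (i - 1))
            (\<lambda>\<omega>. (h (X \<omega>), preceding i (Y \<omega>))) {\<omega>\<in>space M. Y \<omega> \<in> ?A} \<omega>"
        by (rule cond_indep_given_comp_cond_probability_eq[OF Y X h pre]) (use assms A in auto)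
      then show ?thesis
        unfolding pair[OF sp(1)] pair[OF sp(2)] ev
        by (intro variance_cong_AE[symmetric] borel_measurable_integrable
            integrable_cond_probability AM) measurable
    qed
    \<comment> \<open>Positive \<open>p\<close> and \<open>r\<close> keep both sides out of the
      branch \<open>n = 0\<close> of \<open>xi\<close>, also for \<open>i = 1\<close>.\<close>
    then show ?thesis using \<open>p \<ge> 1\<close> \<open>r \<ge> 1\<close> by (simp add: xi_def)
  qed
  then show ?thesis by (simp add: T_def)
qed

end
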